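(* Let $(X,b)$ be a connected weighted graph with $X$ infinite and $\mathcal F_c(X)\subset\mathcal D$, and assume that there is $c>0$ with $\|f\|_\infty^2\le c\,\mathcal E(f)$ for all $f\in\mathcal F_c(X)$. Let $c_P^0$ be the best (smallest) constant $c$ for which this inequality holds for all $f\in\mathcal F_c(X)$. Then $$c_P^0=\mathrm{diam}_{r_0}(X)=\bigl(\text{norm of the embedding }(\mathcal D_0,\|\cdot\|_{\mathcal E})\to(\mathcal F_0(X),\|\cdot\|_\infty)\bigr)^2.$$
   Context: A weighted graph $(X,b)$ consists of a countable set $X$ and a symmetric function $b:X\times X\to[0,\infty)$ with $b(x,x)=0$ for all $x\in X$. It is connected if any two points $x,y\in X$ are joined by a path, i.e. for $x\neq y$ there are $x=x_0,x_1,\dots,x_k=y$ with $b(x_j,x_{j+1})>0$ for $0\le j<k$. $\mathcal F_c(X)$ is the space of finitely supported real functions on $X$. Let $\mathcal D=\{f:X\to\mathbb R\mid \sum_{x,y\in X}b(x,y)|f(x)-f(y)|^2<\infty\}$ and $\mathcal E(f)=\frac12\sum_{x,y\in X}b(x,y)(f(x)-f(y))^2$, $\|f\|_{\mathcal E}=\mathcal E(f)^{1/2}$ for $f\in\mathcal D$. $\|f\|_\infty=\sup_{x\in X}|f(x)|$; $\mathcal F_0(X)$ is the closure of $\mathcal F_c(X)$ with respect to $\|\cdot\|_\infty$. $\mathcal D_0$ denotes the closure of $\mathcal F_c(X)$ in $\mathcal D$ with respect to the norm $\mathcal E(f)^{1/2}$. $r_0(x,y)=\sup\{|f(x)-f(y)|^2\mid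 f\in\mathcal F_c(X),\ f\ge0,\ \mathcal E(f)\le1\}$ and $\mathrm{diam}_{r_0}(X)=\sup_{x,y\in X}r_0(x,y)$.
   Formalization: D_0 is taken as the f in D that are limits of functions in F_c(X) both in E^{1/2} and pointwise, since the closure in D for the seminorm E^{1/2} alone contains the nonzero constants, which are not in F_0(X), so the embedding would not exist. *)

theory Defs
  imports "HOL-Analysis.Analysis"
begin

text \<open>
  The vertex set \<open>X\<close> is the universe of a type of class \<open>countable\<close>, so real functions on \<open>X\<close>
  are exactly the functions \<open>'a \<Rightarrow> real\<close>. Quantities that are suprema of possibly unbounded sets
  take values in \<open>ennreal\<close>, so that no convention for unbounded sets enters.
\<close>

definition weighted_graph :: "('a::countable \<Rightarrow> 'a \<Rightarrow> real) \<Rightarrow> bool" where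
  "weighted_graph b \<longleftrightarrow>
     (\<forall>x y. 0 \<le> b x y) \<and> (\<forall>x y. b x y = b y x) \<and> (\<forall>x. b x x = 0)"

definition connected_graph :: "('a::countable \<Rightarrow> 'a \<Rightarrow> real) \<Rightarrow> bool" where
  "connected_graph b \<longleftrightarrow> (\<forall>x y. (\<lambda>u v. b u v > 0)\<^sup>*\<^sup>* x y)"

definition Fc :: "('a::countable \<Rightarrow> real) set" where
  "Fc = {f. finite {x. f x \<noteq> 0}}"

definition finite_energy :: "('a::countable \<Rightarrow> 'a \<Rightarrow> real) \<Rightarrow> ('a \<Rightarrow> real) set" where
  "finite_energy b = {f. (\<lambda>(x, y). b x y * \<bar>f x - f y\<bar>\<^sup>2) summable_on UNIV}"

text \<open>The value of \<open>energy b f\<close> is meaningful only for \<open>f \<in> finite_energy b\<close>.\<close>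

definition energy :: "('a::countable \<Rightarrow> 'a \<Rightarrow> real) \<Rightarrow> ('a \<Rightarrow> real) \<Rightarrow> real" where
  "energy b f = 1 / 2 * (\<Sum>\<^sub>\<infinity>(x, y)\<in>UNIV. b x y * (f x - f y)\<^sup>2)"

definition energy_norm :: "('a::countable \<Rightarrow> 'a \<Rightarrow> real) \<Rightarrow> ('a \<Rightarrow> real) \<Rightarrow> real" where
  "energy_norm b f = sqrt (energy b f)"

definition sup_norm :: "('a::countable \<Rightarrow> real) \<Rightarrow> ennreal" where
  "sup_norm f = (SUP x. ennreal \<bar>f x\<bar>)"

definition F0 :: "('a::countable \<Rightarrow> real) set" where
  "F0 = {f. \<forall>\<epsilon>>0. \<exists>g\<in>Fc. sup_norm (\<lambda>x. f x - g x) < ennreal \<epsilon>}"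

text \<open>
  On all functions of finite energy, \<open>energy_norm\<close> is only a seminorm: it vanishes on constants.
  The closure of \<open>Fc\<close> for this seminorm alone would contain every constant function
  (approximated by \<open>0\<close>), so it could not embed into \<open>F0\<close>, and \<open>energy_norm\<close> would not be a norm
  on it. As usual, the additive constant is fixed by asking that the approximating sequence also
  converge pointwise.
\<close>

definition D0 :: "('a::countable \<Rightarrow> 'a \<Rightarrow> real) \<Rightarrow> ('a \<Rightarrow> real) set" where
  "D0 b = {f \<in> finite_energy b. \<exists>g. (\<forall>n::nat. g n \<in> Fc) \<and>
      (\<lambda>n. energy_norm b (\<lambda>x. f x - g n x)) \<longlonglongrightarrow> 0 \<and>
      (\<forall>x. (\<lambda>n. g n x) \<longlonglongrightarrow> f x)}"

definition r0 :: "('a::countable \<Rightarrow> 'a \<Rightarrow> real) \<Rightarrow> 'a \<Rightarrow> 'a \<Rightarrow> ennreal" where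
  "r0 b x y = (SUP f\<in>{f \<in> Fc. (\<forall>z. 0 \<le> f z) \<and> energy b f \<le> 1}. ennreal (\<bar>f x - f y\<bar>\<^sup>2))"

definition diam_r0 :: "('a::countable \<Rightarrow> 'a \<Rightarrow> real) \<Rightarrow> ennreal" where
  "diam_r0 b = (SUP x. SUP y. r0 b x y)"

definition poincare_constant :: "('a::countable \<Rightarrow> 'a \<Rightarrow> real) \<Rightarrow> real \<Rightarrow> bool" where
  "poincare_constant b c \<longleftrightarrow> c > 0 \<and> (\<forall>f\<in>Fc. (sup_norm f)\<^sup>2 \<le> ennreal (c * energy b f))"

definition best_poincare_constant :: "('a::countable \<Rightarrow> 'a \<Rightarrow> real) \<Rightarrow> real" where
  "best_poincare_constant b = Inf {c. poincare_constant b c}"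

text \<open>The operator norm of the inclusion of \<open>(D0 b, energy_norm b)\<close> into \<open>(F0, sup_norm)\<close>.\<close>

definition embedding_norm :: "('a::countable \<Rightarrow> 'a \<Rightarrow> real) \<Rightarrow> ennreal" where
  "embedding_norm b = (SUP f\<in>{f \<in> D0 b. energy_norm b f \<le> 1}. sup_norm f)"

end

theory Submission imports Defs begin

text \<open>
  Write \<open>C\<close> for the best constant. The inequality \<open>(f x)\<^sup>2 \<le> C * energy b f\<close> passes from \<open>Fc\<close> to
  \<open>D0\<close> by pointwise limits; applied to \<open>f - g n\<close> it gives uniform convergence, hence
  \<open>D0 \<subseteq> F0\<close>, and it bounds the embedding norm. It bounds the diameter because
  \<open>\<bar>f x - f y\<bar> \<le> max (f x) (f y)\<close> for nonnegative \<open>f\<close>. Conversely, replacing \<open>f\<close> by \<open>\<bar>f\<bar>\<close> does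
  not increase the energy, so \<open>C\<close> is already determined by nonnegative normalised functions in
  \<open>Fc\<close>; since \<open>X\<close> is infinite, \<open>f x\<close> is the difference \<open>f x - f y\<close> for any \<open>y\<close> off the support.
\<close>

section \<open>Squares and sup norms in \<open>ennreal\<close>, and closure properties of
  \<open>Fc\<close>\<close>

lemma ennreal_power2_le_iff:
  fixes a :: ennreal
  assumes "0 \<le> d"
  shows "a\<^sup>2 \<le> ennreal d \<longleftrightarrow> a \<le> ennreal (sqrt d)"
proof (cases a)
  case (real r)
  then have "a\<^sup>2 = ennreal (r\<^sup>2)"
    by (simp add: ennreal_power)
  then show ?thesis
    using real assms by (simp add: real_le_rsqrt sqrt_le_D flip: real_sqrt_le_iff [of "r\<^sup>2"])
qed (simp add: ennreal_top_mult power2_eq_square top_unique)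

lemma sup_norm_le_iff:
  assumes "0 \<le> s"
  shows "sup_norm f \<le> ennreal s \<longleftrightarrow> (\<forall>x. \<bar>f x\<bar> \<le> s)"
  using assms by (simp add: sup_norm_def SUP_le_iff)

text \<open>Bridge from \<open>ennreal\<close> to the reals: Poincare inequalities can then be
  treated as pointwise bounds on \<open>(f x)\<^sup>2\<close>.\<close>

lemma sup_norm_power2_le_iff:
  assumes "0 \<le> d"
  shows "(sup_norm f)\<^sup>2 \<le> ennreal d \<longleftrightarrow> (\<forall>x. (f x)\<^sup>2 \<le> d)"
proof -
  have "\<bar>f x\<bar> \<le> sqrt d \<longleftrightarrow> (f x)\<^sup>2 \<le> d" for x
    using real_sqrt_le_iff [of "(f x)\<^sup>2" d] by simp
  then show ?thesis
    using assms by (simp add: ennreal_power2_le_iff sup_norm_le_iff)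
qed

lemma Fc_indicator: "indicator {x} \<in> Fc"
  by (simp add: Fc_def indicator_def)

lemma Fc_abs: "f \<in> Fc \<Longrightarrow> (\<lambda>x. \<bar>f x\<bar>) \<in> Fc"
  by (simp add: Fc_def)

lemma Fc_cmult: "f \<in> Fc \<Longrightarrow> (\<lambda>x. a * f x) \<in> Fc"
  unfolding Fc_def by (auto elim: rev_finite_subset)

lemma Fc_diff:
  assumes "f \<in> Fc" "g \<in> Fc"
  shows "(\<lambda>x. f x - g x) \<in> Fc"
proof -
  have "{x. f x - g x \<noteq> 0} \<subseteq> {x. f x \<noteq> 0} \<union> {x. g x \<noteq> 0}"
    by auto
  with assms show ?thesis
    unfolding Fc_def by (auto intro: finite_subset)
qed

section \<open>Energy estimates on a weighted graph\<close>

locale weighted =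
  fixes b :: "'a::countable \<Rightarrow> 'a \<Rightarrow> real"
  assumes graph: "weighted_graph b"
begin

lemma b_nonneg: "0 \<le> b x y"
  using graph by (simp add: weighted_graph_def)

lemma energy_nonneg: "0 \<le> energy b f"
  unfolding energy_def by (auto intro!: infsum_nonneg mult_nonneg_nonneg simp: b_nonneg)

lemma finite_energy_iff:
  "f \<in> finite_energy b \<longleftrightarrow> (\<lambda>(x, y). b x y * (f x - f y)\<^sup>2) summable_on UNIV"
  by (simp add: finite_energy_def)

text \<open>Weighting the pointwise bound by \<open>b x y \<ge> 0\<close> gives a termwise
  comparison of series. Finiteness is part of the conclusion because the value of
  \<open>energy\<close> means nothing without it. Allowing two dominating functions covers
  differences and perturbations alike.\<close>

lemma energy_dominated:
  assumes "f \<in> finite_energy b" "g \<in> finite_energy b" "0 \<le> s" "0 \<le> t"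
    and le: "\<And>x y. (h x - h y)\<^sup>2 \<le> s * (f x - f y)\<^sup>2 + t * (g x - g y)\<^sup>2"
  shows "h \<in> finite_energy b" "energy b h \<le> s * energy b f + t * energy b g"
proof -
  define H F G where
    "H = (\<lambda>(x, y). b x y * (h x - h y)\<^sup>2)" and
    "F = (\<lambda>(x, y). b x y * (f x - f y)\<^sup>2)" and
    "G = (\<lambda>(x, y). b x y * (g x - g y)\<^sup>2)"
  have F: "F summable_on UNIV" and G: "G summable_on UNIV"
    using assms by (simp_all add: finite_energy_iff F_def G_def)
  have sF: "(\<lambda>p. s * F p) summable_on UNIV" and tG: "(\<lambda>p. t * G p) summable_on UNIV"
    using F G by (auto intro: summable_on_cmult_right)
  have sum: "(\<lambda>p. s * F p + t * G p) summable_on UNIV"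
    by (rule summable_on_add [OF sF tG])
  have HFG: "H p \<le> s * F p + t * G p" for p
    using mult_left_mono [OF le b_nonneg, of "fst p" "snd p" "fst p" "snd p"]
    by (simp add: H_def F_def G_def split_beta algebra_simps)
  have H0: "0 \<le> H p" for p
    by (simp add: H_def split_beta b_nonneg)
  have H: "H summable_on UNIV"
    by (rule summable_on_comparison_test [OF sum HFG H0])
  then show "h \<in> finite_energy b"
    by (simp add: finite_energy_iff H_def)
  have "infsum H UNIV \<le> (\<Sum>\<^sub>\<infinity>p. s * F p + t * G p)"
    by (rule infsum_mono [OF H sum HFG])
  also have "\<dots> = s * infsum F UNIV + t * infsum G UNIV"
    by (simp add: infsum_add [OF sF tG] infsum_cmult_right F G)
  finally show "energy b h \<le> s * energy b f + t * energy b g"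
    by (simp add: energy_def H_def F_def G_def)
qed

lemma finite_energy_diff:
  assumes "f \<in> finite_energy b" "g \<in> finite_energy b"
  shows "(\<lambda>x. f x - g x) \<in> finite_energy b"
proof (rule energy_dominated(1) [OF assms, where s = 2 and t = 2])
  show "(f x - g x - (f y - g y))\<^sup>2 \<le> 2 * (f x - f y)\<^sup>2 + 2 * (g x - g y)\<^sup>2" for x y
    \<comment> \<open>The gap between the two sides is exactly this square.\<close>
    using zero_le_power2 [of "(f x - f y) + (g x - g y)"]
    by (simp add: power2_eq_square algebra_simps)
qed simp_all

lemma energy_abs_le:
  assumes "f \<in> finite_energy b"
  shows "energy b (\<lambda>x. \<bar>f x\<bar>) \<le> energy b f"
proof -
  \<comment> \<open>Reverse triangle inequality, padded with a zero term to fit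
    \<open>energy_dominated\<close>.\<close>
  have "(\<bar>f x\<bar> - \<bar>f y\<bar>)\<^sup>2 \<le> 1 * (f x - f y)\<^sup>2 + 0 * (f x - f y)\<^sup>2" for x y
    using abs_triangle_ineq3 [of "f x" "f y"] by (simp add: abs_le_square_iff)
  from energy_dominated(2) [OF assms assms _ _ this] show ?thesis
    by simp
qed

lemma energy_cmult: "energy b (\<lambda>x. a * f x) = a\<^sup>2 * energy b f"
proof -
  have "(\<Sum>\<^sub>\<infinity>(x, y). b x y * (a * f x - a * f y)\<^sup>2) = (\<Sum>\<^sub>\<infinity>p. a\<^sup>2 * (case p of (x, y) \<Rightarrow> b x y * (f x - f y)\<^sup>2))"
    by (rule infsum_cong) (auto simp: power2_eq_square algebra_simps)
  also have "\<dots> = a\<^sup>2 * (\<Sum>\<^sub>\<infinity>(x, y). b x y * (f x - f y)\<^sup>2)"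
    by (rule infsum_cmult_right')
  finally show ?thesis
    by (simp add: energy_def)
qed

text \<open>Stands in for the triangle inequality of \<open>energy_norm\<close>, but follows from a
  pointwise estimate. Small \<open>t\<close> brings the factor of \<open>energy b f\<close> as close
  to 1 as desired.\<close>

lemma energy_le_perturbation:
  assumes "f \<in> finite_energy b" "g \<in> finite_energy b" "0 < t"
  shows "energy b g \<le> (1 + t) * energy b f + (1 + 1 / t) * energy b (\<lambda>x. f x - g x)"
proof (rule energy_dominated(2))
  have uv: "(u - v)\<^sup>2 \<le> (1 + t) * u\<^sup>2 + (1 + 1 / t) * v\<^sup>2" for u v :: real
  proof -
    \<comment> \<open>This square yields
      \<open>- 2 * u * v \<le> t * u\<^sup>2 + v\<^sup>2 / t\<close>, which absorbs the cross term
      of \<open>(u - v)\<^sup>2\<close>.\<close>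
    have "0 \<le> (t * u + v)\<^sup>2 / t"
      using assms by simp
    also have "\<dots> = t * u\<^sup>2 + 2 * u * v + v\<^sup>2 / t"
      using assms by (simp add: power2_eq_square field_simps)
    finally show ?thesis
      by (simp add: power2_diff distrib_right)
  qed
  show "(g x - g y)\<^sup>2 \<le> (1 + t) * (f x - f y)\<^sup>2 + (1 + 1 / t) * (f x - g x - (f y - g y))\<^sup>2" for x y
    using uv [of "f x - f y" "f x - g x - (f y - g y)"] by simp
qed (use assms finite_energy_diff in auto)

lemma poincare_constant_iff:
  "poincare_constant b c \<longleftrightarrow> 0 < c \<and> (\<forall>f\<in>Fc. \<forall>x. (f x)\<^sup>2 \<le> c * energy b f)"
  by (auto simp: poincare_constant_def sup_norm_power2_le_iff energy_nonneg)

text \<open>Subtracting \<open>g\<close> from every approximant leaves the differences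
  \<open>f x - h n x\<close> unchanged. This lets \<open>D0_poincare\<close> be applied to
  approximation errors.\<close>

lemma D0_diff_Fc:
  assumes "f \<in> D0 b" "g \<in> Fc" "g \<in> finite_energy b"
  shows "(\<lambda>x. f x - g x) \<in> D0 b"
proof -
  obtain h where h: "\<And>n::nat. h n \<in> Fc" "(\<lambda>n. energy_norm b (\<lambda>x. f x - h n x)) \<longlonglongrightarrow> 0"
    "\<And>x. (\<lambda>n. h n x) \<longlonglongrightarrow> f x" and f: "f \<in> finite_energy b"
    using assms(1) unfolding D0_def by blast
  show ?thesis
    unfolding D0_def
  proof (intro CollectI conjI exI [of _ "\<lambda>n x. h n x - g x"] allI)
    show "(\<lambda>x. f x - g x) \<in> finite_energy b"
      using f assms(3) by (rule finite_energy_diff)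
    show "(\<lambda>n. energy_norm b (\<lambda>x. f x - g x - (h n x - g x))) \<longlonglongrightarrow> 0"
      using h(2) by simp
    show "(\<lambda>x. h n x - g x) \<in> Fc" for n
      using h(1) assms(2) by (rule Fc_diff)
    show "(\<lambda>n. h n x - g x) \<longlonglongrightarrow> f x - g x" for x
      by (intro tendsto_intros h)
  qed
qed

end

section \<open>The best constant and functions that determine it\<close>

locale poincare_graph = weighted +
  assumes Fc_finite_energy: "Fc \<subseteq> finite_energy b"
    and poincare_ex: "\<exists>c. poincare_constant b c"
begin

lemma energy_indicator_pos: "0 < energy b (indicator {x})"
proof -
  obtain c where c: "poincare_constant b c"
    using poincare_ex by blast
  then have "(indicator {x} x)\<^sup>2 \<le> c * energy b (indicator {x})" "0 < c"
    using Fc_indicator unfolding poincare_constant_iff by blast+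
  then have "0 < c * energy b (indicator {x})"
    by simp
  with \<open>0 < c\<close> show ?thesis
    by (simp add: zero_less_mult_iff)
qed

lemma best_poincare_constant_le:
  assumes "poincare_constant b c"
  shows "best_poincare_constant b \<le> c"
  unfolding best_poincare_constant_def
  using assms by (auto intro!: cInf_lower bdd_belowI [of _ 0] simp: poincare_constant_def)

text \<open>The infimum is attained: every admissible constant is at least
  \<open>(f x)\<^sup>2 / energy b f\<close>, hence so is their infimum. At zero energy any
  admissible constant forces \<open>f x = 0\<close>.\<close>

lemma le_best_poincare_constant:
  assumes "f \<in> Fc"
  shows "(f x)\<^sup>2 \<le> best_poincare_constant b * energy b f"
proof (cases "energy b f = 0")
  case True
  then show ?thesis
    using poincare_ex assms unfolding poincare_constant_iff by force
next
  case False
  then have pos: "0 < energy b f"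
    using energy_nonneg [of f] by simp
  have "(f x)\<^sup>2 / energy b f \<le> best_poincare_constant b"
    unfolding best_poincare_constant_def
    using poincare_ex assms pos
    by (intro cInf_greatest) (auto simp: poincare_constant_iff pos_divide_le_eq)
  with pos show ?thesis
    by (simp add: pos_divide_le_eq)
qed

text \<open>The positivity built into \<open>poincare_constant\<close> comes from testing on an
  indicator, which has value 1 at its point and positive energy.\<close>

lemma poincare_constantI:
  assumes "\<And>f x. f \<in> Fc \<Longrightarrow> (f x)\<^sup>2 \<le> c * energy b f"
  shows "poincare_constant b c"
proof -
  have "(indicator {x} x)\<^sup>2 \<le> c * energy b (indicator {x})" for x
    by (rule assms [OF Fc_indicator])
  then have "0 < c * energy b (indicator {x})" for x
    by (simp add: less_le_trans [OF zero_less_one])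
  then have "0 < c"
    using energy_indicator_pos by (metis zero_less_mult_pos2)
  with assms show ?thesis
    by (simp add: poincare_constant_iff)
qed

lemma poincare_best_poincare_constant: "poincare_constant b (best_poincare_constant b)"
  by (rule poincare_constantI [OF le_best_poincare_constant])

lemma best_poincare_constant_pos: "0 < best_poincare_constant b"
  using poincare_best_poincare_constant by (simp add: poincare_constant_def)

text \<open>Both sides of the Poincare inequality are homogeneous of degree 2, so \<open>f\<close>
  can be rescaled. Passing to \<bar>f\<bar> keeps the squares and does not raise the energy.\<close>

lemma best_poincare_constant_leI:
  assumes normalised:
    "\<And>f x. f \<in> Fc \<Longrightarrow> (\<And>z. 0 \<le> f z) \<Longrightarrow> energy b f \<le> 1 \<Longrightarrow> (f x)\<^sup>2 \<le> d"
  shows "best_poincare_constant b \<le> d"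
proof (rule best_poincare_constant_le [OF poincare_constantI])
  fix f :: "'a \<Rightarrow> real" and x assume f: "f \<in> Fc"
  show "(f x)\<^sup>2 \<le> d * energy b f"
  proof (cases "energy b f = 0")
    \<comment> \<open>No rescaling is possible here, but the inequality for the best constant
      already gives \<open>f x = 0\<close>.\<close>
    case True
    then show ?thesis
      using le_best_poincare_constant [OF f, of x] by simp
  next
    case False
    then have pos: "0 < energy b f"
      using energy_nonneg [of f] by simp
    define s where "s = 1 / sqrt (energy b f)"
    have s: "0 \<le> s" "s\<^sup>2 = 1 / energy b f"
      using pos by (simp_all add: s_def power_divide)
    have "energy b (\<lambda>z. s * \<bar>f z\<bar>) = s\<^sup>2 * energy b (\<lambda>z. \<bar>f z\<bar>)"
      by (rule energy_cmult)
    also have "\<dots> \<le> s\<^sup>2 * energy b f"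
      using f Fc_finite_energy by (intro mult_left_mono energy_abs_le) auto
    also have "\<dots> = 1"
      using s pos by simp
    finally have "(s * \<bar>f x\<bar>)\<^sup>2 \<le> d"
      using s f by (intro normalised Fc_cmult Fc_abs) auto
    then show ?thesis
      using s pos by (simp add: power_mult_distrib pos_divide_le_eq)
  qed
qed

section \<open>Extension from \<open>Fc\<close> to \<open>D0\<close> and the embedding into
  \<open>F0\<close>\<close>

lemma D0_poincare:
  assumes "f \<in> D0 b"
  shows "(f x)\<^sup>2 \<le> best_poincare_constant b * energy b f"
proof -
  let ?C = "best_poincare_constant b"
  obtain g where g: "\<And>n::nat. g n \<in> Fc" "(\<lambda>n. energy_norm b (\<lambda>x. f x - g n x)) \<longlonglongrightarrow> 0"
    "\<And>x. (\<lambda>n. g n x) \<longlonglongrightarrow> f x" and f: "f \<in> finite_energy b"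
    using assms unfolding D0_def by blast
  have E: "(\<lambda>n. energy b (\<lambda>x. f x - g n x)) \<longlonglongrightarrow> 0"
    using tendsto_power [OF g(2), of 2] by (simp add: energy_norm_def energy_nonneg)
  \<comment> \<open>The order of limits matters: for fixed \<open>t\<close> the limit in
    \<open>n\<close> removes the term with \<open>1 / t\<close>, and only then does \<open>t\<close>
    tend to 0 from the right.\<close>
  have bound: "(f x)\<^sup>2 \<le> ?C * ((1 + t) * energy b f)" if t: "0 < t" for t
  proof (rule LIMSEQ_le)
    show "(\<lambda>n. (g n x)\<^sup>2) \<longlonglongrightarrow> (f x)\<^sup>2"
      by (intro tendsto_intros g)
    have "(\<lambda>n. ?C * ((1 + t) * energy b f + (1 + 1 / t) * energy b (\<lambda>x. f x - g n x)))
      \<longlonglongrightarrow> ?C * ((1 + t) * energy b f + (1 + 1 / t) * 0)"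
      by (intro tendsto_intros E)
    then show "(\<lambda>n. ?C * ((1 + t) * energy b f + (1 + 1 / t) * energy b (\<lambda>x. f x - g n x)))
      \<longlonglongrightarrow> ?C * ((1 + t) * energy b f)"
      by simp
    have "(g n x)\<^sup>2 \<le> ?C * ((1 + t) * energy b f + (1 + 1 / t) * energy b (\<lambda>x. f x - g n x))" for n
    proof -
      have "g n \<in> finite_energy b"
        using g(1) Fc_finite_energy by blast
      from energy_le_perturbation [OF f this t] show ?thesis
        using le_best_poincare_constant [OF g(1), of n x] best_poincare_constant_pos
        by (meson less_imp_le mult_left_mono order_trans)
    qed
    then show "\<exists>N. \<forall>n\<ge>N. (g n x)\<^sup>2 \<le>
        ?C * ((1 + t) * energy b f + (1 + 1 / t) * energy b (\<lambda>x. f x - g n x))"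
      by blast
  qed
  have "((\<lambda>t. ?C * ((1 + t) * energy b f)) \<longlongrightarrow> ?C * ((1 + 0) * energy b f)) (at_right 0)"
    by (intro tendsto_intros)
  then have "(f x)\<^sup>2 \<le> ?C * ((1 + 0) * energy b f)"
  proof (rule tendsto_lowerbound)
    show "\<forall>\<^sub>F t in at_right 0. (f x)\<^sup>2 \<le> ?C * ((1 + t) * energy b f)"
      using eventually_at_right_less by (rule eventually_mono) (rule bound)
  qed simp
  then show ?thesis
    by simp
qed

lemma D0_subset_F0: "D0 b \<subseteq> F0"
proof
  fix f assume f: "f \<in> D0 b"
  let ?C = "best_poincare_constant b"
  obtain g where g: "\<And>n::nat. g n \<in> Fc" "(\<lambda>n. energy_norm b (\<lambda>x. f x - g n x)) \<longlonglongrightarrow> 0"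
    using f unfolding D0_def by blast
  have lim: "(\<lambda>n. sqrt ?C * energy_norm b (\<lambda>x. f x - g n x)) \<longlonglongrightarrow> 0"
    using tendsto_mult_right_zero [OF g(2)] by simp
  show "f \<in> F0"
    unfolding F0_def
  proof (intro CollectI allI impI)
    fix \<epsilon> :: real assume "0 < \<epsilon>"
    then have "\<forall>\<^sub>F n in sequentially. sqrt ?C * energy_norm b (\<lambda>x. f x - g n x) < \<epsilon>"
      by (rule order_tendstoD(2) [OF lim])
    then obtain n where n: "sqrt ?C * energy_norm b (\<lambda>x. f x - g n x) < \<epsilon>"
      using eventually_happens' [OF sequentially_bot] by blast
    let ?h = "\<lambda>x. f x - g n x"
    \<comment> \<open>Through the inequality on \<open>D0\<close>, a small energy of the error
      becomes a small sup norm.\<close>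
    have "?h \<in> D0 b"
      using f g(1) Fc_finite_energy by (intro D0_diff_Fc) auto
    then have "(sup_norm ?h)\<^sup>2 \<le> ennreal (?C * energy b ?h)"
      using D0_poincare best_poincare_constant_pos
      by (subst sup_norm_power2_le_iff) (auto simp: energy_nonneg)
    then have "sup_norm ?h \<le> ennreal (sqrt ?C * energy_norm b ?h)"
      using best_poincare_constant_pos
      by (simp add: ennreal_power2_le_iff energy_nonneg real_sqrt_mult energy_norm_def)
    also have "\<dots> < ennreal \<epsilon>"
      using n \<open>0 < \<epsilon>\<close> by (simp add: ennreal_lessI)
    finally show "\<exists>g\<in>Fc. sup_norm (\<lambda>x. f x - g x) < ennreal \<epsilon>"
      using g(1) by blast
  qed
qed

lemma Fc_subset_D0: "Fc \<subseteq> D0 b"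
proof
  fix f :: "'a \<Rightarrow> real" assume f: "f \<in> Fc"
  have "energy_norm b (\<lambda>x. f x - f x) = 0"
    by (simp add: energy_norm_def energy_def case_prod_unfold)
  with f Fc_finite_energy show "f \<in> D0 b"
    unfolding D0_def by (auto intro!: exI [of _ "\<lambda>_. f"])
qed

section \<open>The embedding norm and the diameter\<close>

lemma embedding_norm_eq: "(embedding_norm b)\<^sup>2 = ennreal (best_poincare_constant b)"
proof (rule antisym)
  let ?C = "best_poincare_constant b"
  have C: "0 \<le> ?C"
    using best_poincare_constant_pos by simp
  have "sup_norm f \<le> ennreal (sqrt ?C)" if "f \<in> D0 b" "energy_norm b f \<le> 1" for f
  proof -
    have "(f x)\<^sup>2 \<le> ?C" for x
    proof -
      have "(f x)\<^sup>2 \<le> ?C * energy b f"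
        by (rule D0_poincare [OF that(1)])
      also have "\<dots> \<le> ?C * 1"
        using that C by (intro mult_left_mono) (auto simp: energy_norm_def)
      finally show ?thesis
        by simp
    qed
    then show ?thesis
      using C by (simp flip: ennreal_power2_le_iff add: sup_norm_power2_le_iff)
  qed
  then have "embedding_norm b \<le> ennreal (sqrt ?C)"
    unfolding embedding_norm_def by (auto intro: SUP_least)
  with C show le: "(embedding_norm b)\<^sup>2 \<le> ennreal ?C"
    by (simp add: ennreal_power2_le_iff)
  \<comment> \<open>The upper bound shows that the value is finite, so the reverse inequality can be
    proved for a real number \<open>d\<close>.\<close>
  then obtain d where d: "0 \<le> d" "(embedding_norm b)\<^sup>2 = ennreal d"
    by (metis ennreal_cases ennreal_neq_top top_unique)
  have "?C \<le> d"
  proof (rule best_poincare_constant_leI)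
    fix f x assume f: "f \<in> Fc" "energy b f \<le> 1"
    then have "sup_norm f \<le> embedding_norm b"
      unfolding embedding_norm_def using Fc_subset_D0
      by (intro SUP_upper) (auto simp: energy_norm_def)
    then have "(sup_norm f)\<^sup>2 \<le> ennreal d"
      unfolding d(2) [symmetric] by (intro power_mono) auto
    then show "(f x)\<^sup>2 \<le> d"
      using d(1) by (simp add: sup_norm_power2_le_iff)
  qed
  then show "ennreal ?C \<le> (embedding_norm b)\<^sup>2"
    by (simp add: d ennreal_leI)
qed

lemma diam_r0_eq:
  assumes "infinite (UNIV :: 'a set)"
  shows "diam_r0 b = ennreal (best_poincare_constant b)"
proof (rule antisym)
  let ?C = "best_poincare_constant b"
  have C: "0 \<le> ?C"
    using best_poincare_constant_pos by simp
  have "\<bar>f x - f y\<bar>\<^sup>2 \<le> ?C" if f: "f \<in> Fc" "\<And>z. 0 \<le> f z" "energy b f \<le> 1" for f x y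
  proof -
    have sq: "(f z)\<^sup>2 \<le> ?C" for z
      using le_best_poincare_constant [OF f(1), of z] mult_left_mono [OF f(3) C] by simp
    \<comment> \<open>Nonnegativity allows the maximum instead of the sum of absolute values, which
      would cost a factor 4 after squaring.\<close>
    have "\<bar>f x - f y\<bar> \<le> max (f x) (f y)"
      using f(2) [of x] f(2) [of y] by auto
    then have "\<bar>f x - f y\<bar>\<^sup>2 \<le> (max (f x) (f y))\<^sup>2"
      by (intro power_mono) auto
    also have "\<dots> \<le> ?C"
      using sq by (simp add: max_def)
    finally show ?thesis .
  qed
  then show le: "diam_r0 b \<le> ennreal ?C"
    unfolding diam_r0_def r0_def by (auto intro!: SUP_least ennreal_leI)
  then obtain d where d: "0 \<le> d" "diam_r0 b = ennreal d"
    by (metis ennreal_cases ennreal_neq_top top_unique)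
  have "?C \<le> d"
  proof (rule best_poincare_constant_leI)
    fix f x assume f: "f \<in> Fc" "\<And>z. 0 \<le> f z" "energy b f \<le> 1"
    \<comment> \<open>A finite support cannot exhaust an infinite vertex set.\<close>
    obtain y where y: "f y = 0"
      using f(1) assms unfolding Fc_def by (metis (mono_tags) ex_new_if_finite mem_Collect_eq)
    have "ennreal (\<bar>f x - f y\<bar>\<^sup>2) \<le> r0 b x y"
      unfolding r0_def using f by (intro SUP_upper) auto
    also have "\<dots> \<le> diam_r0 b"
      unfolding diam_r0_def by (rule SUP_upper2 [OF UNIV_I], rule SUP_upper [OF UNIV_I])
    finally show "(f x)\<^sup>2 \<le> d"
      using d y by simp
  qed
  then show "ennreal ?C \<le> diam_r0 b"
    by (simp add: d ennreal_leI)
qed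

end

theorem proposition4p4:
  fixes b :: "'a::countable \<Rightarrow> 'a \<Rightarrow> real"
  assumes "weighted_graph b"
    and "connected_graph b"
    and "infinite (UNIV :: 'a set)"
    and "Fc \<subseteq> finite_energy b"
    and "\<exists>c. poincare_constant b c"
  shows "poincare_constant b (best_poincare_constant b)
    \<and> D0 b \<subseteq> F0
    \<and> ennreal (best_poincare_constant b) = diam_r0 b
    \<and> diam_r0 b = (embedding_norm b)\<^sup>2"
proof -
  interpret poincare_graph b
    using assms by unfold_locales
  show ?thesis
    using poincare_best_poincare_constant D0_subset_F0 diam_r0_eq [OF assms(3)] embedding_norm_eq
    by simp
qed

end
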